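(* Let $K$ be a field, $\lambda\in K$, and let $(A,\mu,\Delta,\alpha,\beta,\psi,\omega)$ be a $\lambda$-infBH-bialgebra. Then $\mathfrak D=\mu\circ\Delta:A\to A$ is a $\lambda$-$(\alpha\omega,\beta\psi)$-derivation, i.e. $$\mathfrak D(ab)=\alpha\omega(a)\,\mathfrak D(b)+\mathfrak D(a)\,\beta\psi(b)+\lambda\,\alpha\omega(a)\,\beta\psi(b)\qquad\text{for all }a,b\in A.$$
   Context: BiHom-associative algebra $(A,\mu,\alpha,\beta)$: a $K$-vector space with linear $\mu$ (written $ab$), $\alpha,\beta:A\to A$ with $\alpha\beta=\beta\alpha$, $\alpha,\beta$ multiplicative, $\alpha(a)(bc)=(ab)\beta(c)$. BiHom-coassociative coalgebra $(A,\Delta,\psi,\omega)$: $\psi\omega=\omega\psi$, $(\psi\otimes\psi)\Delta=\Delta\psi$, $(\omega\otimes\omega)\Delta=\Delta\omega$, $(\Delta\otimes\psi)\Delta=(\omega\otimes\Delta)\Delta$. $\lambda$-infBH-bialgebra $(A,\mu,\Delta,\alpha,\beta,\psi,\omega)$: $(A,\mu,\alpha,\beta)$ is BiHom-associative, $(A,\Delta,\psi,\omega)$ is BiHom-coassociative, each of $\alpha,\beta$ commutes with each of $\psi,\omega$, $(\alpha\otimes\alpha)\Delta=\Delta\alpha$, $(\beta\otimes\beta)\Delta=\Delta\beta$, $\psi,\omega$ are multiplicative, and (with $\Delta(a)=a_1\otimes a_2$) $\Delta(ab)=\omega(a)b_1\otimes\beta(b_2)+\alpha(a_1)\otimes a_2\psi(b)+\lambda\,\alpha\omega(a)\otimes\beta\psi(b)$.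 For algebra maps (multiplicative linear maps) $\xi,\zeta:A\to A$, a $\lambda$-$(\xi,\zeta)$-derivation is a linear map $\mathfrak D$ with $\mathfrak D(ab)=\xi(a)\mathfrak D(b)+\mathfrak D(a)\zeta(b)+\lambda\xi(a)\zeta(b)$. *)

theory Defs
  imports "HOL-Algebra.Module" "HOL-Algebra.AbelCoset"
begin

text \<open>
  A vector space over a field \<open>K\<close> is a \<open>module\<close> over \<open>K\<close> in the sense of HOL-Algebra.
  The ring fields \<open>mult\<close> and \<open>one\<close> of the \<open>module\<close> record play no role in that locale;
  they are left unspecified in the constructions below.
\<close>

definition linear_maps ::
  "('k, 'r) ring_scheme \<Rightarrow> ('k, 'a, 'm) module_scheme \<Rightarrow> ('k, 'b, 'n) module_scheme \<Rightarrow> ('a \<Rightarrow> 'b) set"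
  where "linear_maps K M N =
    {h \<in> hom (add_monoid M) (add_monoid N).
       \<forall>k\<in>carrier K. \<forall>x\<in>carrier M. h (k \<odot>\<^bsub>M\<^esub> x) = k \<odot>\<^bsub>N\<^esub> h x}"

subsection \<open>Tensor products\<close>

definition free_module :: "('k, 'r) ring_scheme \<Rightarrow> 's set \<Rightarrow> ('k, 's \<Rightarrow> 'k) module"
  where "free_module K S =
    \<lparr>carrier = {f. f ` S \<subseteq> carrier K \<and> finite {s. f s \<noteq> \<zero>\<^bsub>K\<^esub>} \<and> {s. f s \<noteq> \<zero>\<^bsub>K\<^esub>} \<subseteq> S},
     monoid.mult = undefined, one = undefined,
     zero = (\<lambda>_. \<zero>\<^bsub>K\<^esub>),
     add = (\<lambda>f g s. f s \<oplus>\<^bsub>K\<^esub> g s),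
     smult = (\<lambda>k f s. k \<otimes>\<^bsub>K\<^esub> f s)\<rparr>"

definition free_gen :: "('k, 'r) ring_scheme \<Rightarrow> 's \<Rightarrow> 's \<Rightarrow> 'k"
  where "free_gen K s = (\<lambda>t. if t = s then \<one>\<^bsub>K\<^esub> else \<zero>\<^bsub>K\<^esub>)"

text \<open>The linear extension of \<open>b : S \<rightarrow> P\<close> to the free module on \<open>S\<close>.\<close>

definition free_lift ::
  "('k, 'r) ring_scheme \<Rightarrow> ('k, 'c, 'p) module_scheme \<Rightarrow> ('s \<Rightarrow> 'c) \<Rightarrow> ('s \<Rightarrow> 'k) \<Rightarrow> 'c"
  where "free_lift K P b f = (\<Oplus>\<^bsub>P\<^esub>s\<in>{s. f s \<noteq> \<zero>\<^bsub>K\<^esub>}. f s \<odot>\<^bsub>P\<^esub> b s)"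

definition quotient_module ::
  "('k, 'a, 'm) module_scheme \<Rightarrow> 'a set \<Rightarrow> ('k, 'a set) module"
  where "quotient_module M U =
    \<lparr>carrier = a_rcosets\<^bsub>M\<^esub> U,
     monoid.mult = undefined, one = undefined,
     zero = U,
     add = (\<lambda>X Y. X <+>\<^bsub>M\<^esub> Y),
     smult = (\<lambda>k X. \<Union>x\<in>X. U +>\<^bsub>M\<^esub> (k \<odot>\<^bsub>M\<^esub> x))\<rparr>"

definition tensor_relators ::
  "('k, 'r) ring_scheme \<Rightarrow> ('k, 'a, 'm) module_scheme \<Rightarrow> ('k, 'b, 'n) module_scheme
    \<Rightarrow> ('a \<times> 'b \<Rightarrow> 'k) set"
  where "tensor_relators K M N =
    (let F = free_module K (carrier M \<times> carrier N); d = (\<lambda>x y. free_gen K (x, y)) in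
      {d (x \<oplus>\<^bsub>M\<^esub> x') y \<ominus>\<^bsub>F\<^esub> (d x y \<oplus>\<^bsub>F\<^esub> d x' y) | x x' y.
          x \<in> carrier M \<and> x' \<in> carrier M \<and> y \<in> carrier N}
    \<union> {d x (y \<oplus>\<^bsub>N\<^esub> y') \<ominus>\<^bsub>F\<^esub> (d x y \<oplus>\<^bsub>F\<^esub> d x y') | x y y'.
          x \<in> carrier M \<and> y \<in> carrier N \<and> y' \<in> carrier N}
    \<union> {d (k \<odot>\<^bsub>M\<^esub> x) y \<ominus>\<^bsub>F\<^esub> (k \<odot>\<^bsub>F\<^esub> d x y) | k x y.
          k \<in> carrier K \<and> x \<in> carrier M \<and> y \<in> carrier N}
    \<union> {d x (k \<odot>\<^bsub>N\<^esub> y) \<ominus>\<^bsub>F\<^esub> (k \<odot>\<^bsub>F\<^esub> d x y) | k x y.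
          k \<in> carrier K \<and> x \<in> carrier M \<and> y \<in> carrier N})"

definition tensor_kernel ::
  "('k, 'r) ring_scheme \<Rightarrow> ('k, 'a, 'm) module_scheme \<Rightarrow> ('k, 'b, 'n) module_scheme
    \<Rightarrow> ('a \<times> 'b \<Rightarrow> 'k) set"
  where "tensor_kernel K M N =
    \<Inter>{H. submodule H K (free_module K (carrier M \<times> carrier N)) \<and> tensor_relators K M N \<subseteq> H}"

definition tensor ::
  "('k, 'r) ring_scheme \<Rightarrow> ('k, 'a, 'm) module_scheme \<Rightarrow> ('k, 'b, 'n) module_scheme
    \<Rightarrow> ('k, ('a \<times> 'b \<Rightarrow> 'k) set) module"
  where "tensor K M N =
    quotient_module (free_module K (carrier M \<times> carrier N)) (tensor_kernel K M N)"

definition pure_tensor ::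
  "('k, 'r) ring_scheme \<Rightarrow> ('k, 'a, 'm) module_scheme \<Rightarrow> ('k, 'b, 'n) module_scheme
    \<Rightarrow> 'a \<Rightarrow> 'b \<Rightarrow> ('a \<times> 'b \<Rightarrow> 'k) set"
  where "pure_tensor K M N x y =
    tensor_kernel K M N +>\<^bsub>free_module K (carrier M \<times> carrier N)\<^esub> free_gen K (x, y)"

text \<open>
  The linear map \<open>M \<otimes> N \<rightarrow> P\<close> induced by a bilinear map \<open>b : M \<times> N \<rightarrow> P\<close>, evaluated on an
  arbitrary representative (see \<open>tensor_lift_pure\<close>, \<open>tensor_lift_linear\<close> and
  \<open>tensor_linear_unique\<close> for the universal property).
\<close>

definition tensor_lift ::
  "('k, 'r) ring_scheme \<Rightarrow> ('k, 'c, 'p) module_scheme \<Rightarrow> ('a \<Rightarrow> 'b \<Rightarrow> 'c)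
    \<Rightarrow> ('a \<times> 'b \<Rightarrow> 'k) set \<Rightarrow> 'c"
  where "tensor_lift K P b T = free_lift K P (\<lambda>(x, y). b x y) (SOME f. f \<in> T)"

text \<open>\<open>f \<otimes> g : M \<otimes> N \<rightarrow> P \<otimes> Q\<close> for linear \<open>f : M \<rightarrow> P\<close> and \<open>g : N \<rightarrow> Q\<close>.\<close>

definition tensor_map ::
  "('k, 'r) ring_scheme \<Rightarrow> ('k, 'c, 'p) module_scheme \<Rightarrow> ('k, 'd, 'q) module_scheme
    \<Rightarrow> ('a \<Rightarrow> 'c) \<Rightarrow> ('b \<Rightarrow> 'd) \<Rightarrow> ('a \<times> 'b \<Rightarrow> 'k) set \<Rightarrow> ('c \<times> 'd \<Rightarrow> 'k) set"
  where "tensor_map K P Q f g =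
    tensor_lift K (tensor K P Q) (\<lambda>x y. pure_tensor K P Q (f x) (g y))"

text \<open>\<open>(x \<otimes> y) \<otimes> z \<mapsto> x \<otimes> (y \<otimes> z)\<close>\<close>

definition tensor_assoc ::
  "('k, 'r) ring_scheme \<Rightarrow> ('k, 'a, 'm) module_scheme \<Rightarrow> ('k, 'b, 'n) module_scheme
    \<Rightarrow> ('k, 'c, 'p) module_scheme
    \<Rightarrow> (('a \<times> 'b \<Rightarrow> 'k) set \<times> 'c \<Rightarrow> 'k) set \<Rightarrow> ('a \<times> ('b \<times> 'c \<Rightarrow> 'k) set \<Rightarrow> 'k) set"
  where "tensor_assoc K M N P =
    (let T = tensor K M (tensor K N P) in
      tensor_lift K T (\<lambda>t z.
        tensor_lift K T (\<lambda>x y.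
          pure_tensor K M (tensor K N P) x (pure_tensor K N P y z)) t))"

subsection \<open>The universal property\<close>

definition bilinear_maps ::
  "('k, 'r) ring_scheme \<Rightarrow> ('k, 'a, 'm) module_scheme \<Rightarrow> ('k, 'b, 'n) module_scheme
    \<Rightarrow> ('k, 'c, 'p) module_scheme \<Rightarrow> ('a \<Rightarrow> 'b \<Rightarrow> 'c) set"
  where "bilinear_maps K M N P =
    {b. (\<forall>y\<in>carrier N. (\<lambda>x. b x y) \<in> linear_maps K M P) \<and>
        (\<forall>x\<in>carrier M. b x \<in> linear_maps K N P)}"

lemma linear_mapsI:
  assumes "\<And>x. x \<in> carrier M \<Longrightarrow> h x \<in> carrier N"
    and "\<And>x y. x \<in> carrier M \<Longrightarrow> y \<in> carrier M \<Longrightarrow> h (x \<oplus>\<^bsub>M\<^esub> y) = h x \<oplus>\<^bsub>N\<^esub> h y"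
    and "\<And>k x. k \<in> carrier K \<Longrightarrow> x \<in> carrier M \<Longrightarrow> h (k \<odot>\<^bsub>M\<^esub> x) = k \<odot>\<^bsub>N\<^esub> h x"
  shows "h \<in> linear_maps K M N"
  using assms by (auto simp: linear_maps_def hom_def)

lemma linear_mapsD:
  assumes "h \<in> linear_maps K M N"
  shows "x \<in> carrier M \<Longrightarrow> h x \<in> carrier N"
    and "x \<in> carrier M \<Longrightarrow> y \<in> carrier M \<Longrightarrow> h (x \<oplus>\<^bsub>M\<^esub> y) = h x \<oplus>\<^bsub>N\<^esub> h y"
    and "k \<in> carrier K \<Longrightarrow> x \<in> carrier M \<Longrightarrow> h (k \<odot>\<^bsub>M\<^esub> x) = k \<odot>\<^bsub>N\<^esub> h x"
  using assms by (auto simp: linear_maps_def hom_def)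

lemma bilinear_mapsD:
  assumes "b \<in> bilinear_maps K M N P"
  shows "y \<in> carrier N \<Longrightarrow> (\<lambda>x. b x y) \<in> linear_maps K M P"
    and "x \<in> carrier M \<Longrightarrow> b x \<in> linear_maps K N P"
    and "(\<lambda>(x, y). b x y) ` (carrier M \<times> carrier N) \<subseteq> carrier P"
proof -
  show "(\<lambda>x. b x y) \<in> linear_maps K M P" if "y \<in> carrier N" for y
    using assms that by (auto simp: bilinear_maps_def)
  show b2: "b x \<in> linear_maps K N P" if "x \<in> carrier M" for x
    using assms that by (auto simp: bilinear_maps_def)
  show "(\<lambda>(x, y). b x y) ` (carrier M \<times> carrier N) \<subseteq> carrier P"
    using linear_mapsD(1)[OF b2] by auto
qed

lemma linear_maps_kernel_submodule:
  assumes "module K M" "module K N" "h \<in> linear_maps K M N"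
  shows "submodule {x \<in> carrier M. h x = \<zero>\<^bsub>N\<^esub>} K M"
proof -
  interpret M: module K M by fact
  interpret N: module K N by fact
  note h = linear_mapsD[OF assms(3)]
  have z: "h \<zero>\<^bsub>M\<^esub> = \<zero>\<^bsub>N\<^esub>"
    using h(3)[of "\<zero>\<^bsub>K\<^esub>" "\<zero>\<^bsub>M\<^esub>"] h(1)[of "\<zero>\<^bsub>M\<^esub>"] by simp
  show ?thesis
  proof (rule M.submoduleI)
    fix a assume "a \<in> {x \<in> carrier M. h x = \<zero>\<^bsub>N\<^esub>}"
    then show "\<ominus>\<^bsub>M\<^esub> a \<in> {x \<in> carrier M. h x = \<zero>\<^bsub>N\<^esub>}"
      using h(2)[of a "\<ominus>\<^bsub>M\<^esub> a"] h(1)[of "\<ominus>\<^bsub>M\<^esub> a"] z by (simp add: M.M.r_neg)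
  qed (use z h in auto)
qed

context cring
begin

lemma free_module_carrierD:
  assumes "f \<in> carrier (free_module R S)"
  shows "f s \<in> carrier R" "finite {s. f s \<noteq> \<zero>}" "{s. f s \<noteq> \<zero>} \<subseteq> S" "s \<notin> S \<Longrightarrow> f s = \<zero>"
proof -
  show fin: "finite {s. f s \<noteq> \<zero>}" and sub: "{s. f s \<noteq> \<zero>} \<subseteq> S"
    using assms by (simp_all add: free_module_def)
  show "f s = \<zero>" if "s \<notin> S" for s using sub that by auto
  then show "f s \<in> carrier R"
    using assms by (cases "s \<in> S") (auto simp: free_module_def)
qed

lemma free_module_carrierI:
  assumes "\<And>s. f s \<in> carrier R" "finite T" "T \<subseteq> S" "\<And>s. s \<notin> T \<Longrightarrow> f s = \<zero>"
  shows "f \<in> carrier (free_module R S)"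
proof -
  have "{s. f s \<noteq> \<zero>} \<subseteq> T" using assms(4) by auto
  then show ?thesis using assms by (auto simp: free_module_def intro: finite_subset)
qed

lemma free_module_simps:
  "\<zero>\<^bsub>free_module R S\<^esub> = (\<lambda>_. \<zero>)"
  "f \<oplus>\<^bsub>free_module R S\<^esub> g = (\<lambda>s. f s \<oplus> g s)"
  "k \<odot>\<^bsub>free_module R S\<^esub> f = (\<lambda>s. k \<otimes> f s)"
  by (auto simp: free_module_def)

lemma free_module_closed:
  "f \<in> carrier (free_module R S) \<Longrightarrow> g \<in> carrier (free_module R S)
    \<Longrightarrow> (\<lambda>s. f s \<oplus> g s) \<in> carrier (free_module R S)"
  "k \<in> carrier R \<Longrightarrow> f \<in> carrier (free_module R S)
    \<Longrightarrow> (\<lambda>s. k \<otimes> f s) \<in> carrier (free_module R S)"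
  "(\<lambda>s. \<zero>) \<in> carrier (free_module R S)"
  "s \<in> S \<Longrightarrow> free_gen R s \<in> carrier (free_module R S)"
proof -
  show "(\<lambda>s. f s \<oplus> g s) \<in> carrier (free_module R S)"
    if "f \<in> carrier (free_module R S)" "g \<in> carrier (free_module R S)"
    by (rule free_module_carrierI[where T = "{s. f s \<noteq> \<zero>} \<union> {s. g s \<noteq> \<zero>}"])
      (use free_module_carrierD[OF that(1)] free_module_carrierD[OF that(2)] in auto)
  show "(\<lambda>s. k \<otimes> f s) \<in> carrier (free_module R S)"
    if "k \<in> carrier R" "f \<in> carrier (free_module R S)"
    by (rule free_module_carrierI[where T = "{s. f s \<noteq> \<zero>}"])
      (use that(1) free_module_carrierD[OF that(2)] in auto)
  show "(\<lambda>s. \<zero>) \<in> carrier (free_module R S)"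
    by (rule free_module_carrierI[where T = "{}"]) auto
  show "free_gen R s \<in> carrier (free_module R S)" if "s \<in> S"
    by (rule free_module_carrierI[where T = "{s}"]) (use that in \<open>auto simp: free_gen_def\<close>)
qed

lemma free_module_module: "module R (free_module R S)"
proof (rule moduleI)
  show "cring R" by (rule cring_axioms)
  show "abelian_group (free_module R S)"
  proof (rule abelian_groupI)
    fix f assume f: "f \<in> carrier (free_module R S)"
    note fD = free_module_carrierD[OF f]
    show "\<exists>g\<in>carrier (free_module R S). g \<oplus>\<^bsub>free_module R S\<^esub> f = \<zero>\<^bsub>free_module R S\<^esub>"
    proof (rule bexI)
      show "(\<lambda>s. (\<ominus> \<one>) \<otimes> f s) \<in> carrier (free_module R S)"
        by (rule free_module_closed) (use f in auto)
      show "(\<lambda>s. (\<ominus> \<one>) \<otimes> f s) \<oplus>\<^bsub>free_module R S\<^esub> f = \<zero>\<^bsub>free_module R S\<^esub>"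
        by (simp add: free_module_simps l_minus l_neg fD(1))
    qed
  next
    fix f g h assume "f \<in> carrier (free_module R S)" "g \<in> carrier (free_module R S)"
      "h \<in> carrier (free_module R S)"
    note D = this[THEN free_module_carrierD(1)]
    show "f \<oplus>\<^bsub>free_module R S\<^esub> g \<oplus>\<^bsub>free_module R S\<^esub> h =
      f \<oplus>\<^bsub>free_module R S\<^esub> (g \<oplus>\<^bsub>free_module R S\<^esub> h)"
      by (simp add: free_module_simps a_assoc D)
  next
    fix f g assume "f \<in> carrier (free_module R S)" "g \<in> carrier (free_module R S)"
    note D = this[THEN free_module_carrierD(1)]
    show "f \<oplus>\<^bsub>free_module R S\<^esub> g = g \<oplus>\<^bsub>free_module R S\<^esub> f"
      by (simp add: free_module_simps a_comm D)
  next
    fix f assume "f \<in> carrier (free_module R S)"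
    note D = this[THEN free_module_carrierD(1)]
    show "\<zero>\<^bsub>free_module R S\<^esub> \<oplus>\<^bsub>free_module R S\<^esub> f = f"
      by (simp add: free_module_simps D)
  qed (auto simp: free_module_simps intro: free_module_closed)
next
  fix a b f assume ab: "a \<in> carrier R" "b \<in> carrier R" and "f \<in> carrier (free_module R S)"
  note D = this(3)[THEN free_module_carrierD(1)]
  show "(a \<oplus> b) \<odot>\<^bsub>free_module R S\<^esub> f =
    a \<odot>\<^bsub>free_module R S\<^esub> f \<oplus>\<^bsub>free_module R S\<^esub> b \<odot>\<^bsub>free_module R S\<^esub> f"
    by (simp add: free_module_simps l_distr ab D)
  show "a \<otimes> b \<odot>\<^bsub>free_module R S\<^esub> f = a \<odot>\<^bsub>free_module R S\<^esub> (b \<odot>\<^bsub>free_module R S\<^esub> f)"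
    by (simp add: free_module_simps m_assoc ab D)
next
  fix a f g assume a: "a \<in> carrier R"
    and "f \<in> carrier (free_module R S)" "g \<in> carrier (free_module R S)"
  note D = this(2,3)[THEN free_module_carrierD(1)]
  show "a \<odot>\<^bsub>free_module R S\<^esub> (f \<oplus>\<^bsub>free_module R S\<^esub> g) =
    a \<odot>\<^bsub>free_module R S\<^esub> f \<oplus>\<^bsub>free_module R S\<^esub> a \<odot>\<^bsub>free_module R S\<^esub> g"
    by (simp add: free_module_simps r_distr a D)
next
  fix f assume "f \<in> carrier (free_module R S)"
  note D = this[THEN free_module_carrierD(1)]
  show "\<one> \<odot>\<^bsub>free_module R S\<^esub> f = f"
    by (simp add: free_module_simps D)
qed (auto simp: free_module_simps intro: free_module_closed)

lemma free_module_induct [consumes 1, case_names zero step]: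
  assumes "f \<in> carrier (free_module R S)"
    and "Q (\<lambda>_. \<zero>)"
    and "\<And>g k s. g \<in> carrier (free_module R S) \<Longrightarrow> k \<in> carrier R \<Longrightarrow> s \<in> S \<Longrightarrow> Q g
      \<Longrightarrow> Q (g \<oplus>\<^bsub>free_module R S\<^esub> k \<odot>\<^bsub>free_module R S\<^esub> free_gen R s)"
  shows "Q f"
proof -
  have "\<lbrakk>finite T; f \<in> carrier (free_module R S); {s. f s \<noteq> \<zero>} = T\<rbrakk> \<Longrightarrow> Q f" for T f
  proof (induction T arbitrary: f rule: finite_induct)
    case empty
    then have "f = (\<lambda>_. \<zero>)" by auto
    then show ?case using assms(2) by simp
  next
    case (insert s T)
    note fD = free_module_carrierD[OF insert.prems(1)]
    define g where "g = f(s := \<zero>)"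
    have gS: "{t. g t \<noteq> \<zero>} = T" using insert.prems(2) insert.hyps(2) by (auto simp: g_def)
    have g: "g \<in> carrier (free_module R S)"
      by (rule free_module_carrierI[where T = T])
        (use fD gS insert in \<open>auto simp: g_def\<close>)
    have s: "s \<in> S" using insert.prems(2) fD(3) by auto
    have "f = g \<oplus>\<^bsub>free_module R S\<^esub> f s \<odot>\<^bsub>free_module R S\<^esub> free_gen R s"
      by (rule ext) (simp add: free_module_simps g_def free_gen_def fD(1))
    then show ?case using assms(3)[OF g fD(1) s insert.IH[OF g gS]] by metis
  qed
  then show ?thesis using assms(1) free_module_carrierD(2)[OF assms(1)] by blast
qed

lemma free_lift:
  assumes "module R P" "b ` S \<subseteq> carrier P"
  shows "free_lift R P b \<in> linear_maps R (free_module R S) P"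
    and "s \<in> S \<Longrightarrow> free_lift R P b (free_gen R s) = b s"
proof -
  define E where "E = free_lift R P b"
  note E_def' = E_def free_lift_def
  interpret P: module R P by fact
  have sup: "E f = (\<Oplus>\<^bsub>P\<^esub>s\<in>T. f s \<odot>\<^bsub>P\<^esub> b s)"
    if "f \<in> carrier (free_module R S)" "finite T" "{s. f s \<noteq> \<zero>} \<subseteq> T" "T \<subseteq> S" for f T
    unfolding E_def'
    by (rule P.M.add.finprod_mono_neutral_cong_left)
      (use that free_module_carrierD[OF that(1)] assms(2) in \<open>auto simp: Pi_def image_subset_iff subset_iff\<close>)
  show "free_lift R P b \<in> linear_maps R (free_module R S) P"
    unfolding E_def[symmetric]
  proof (rule linear_mapsI)
    fix f assume f: "f \<in> carrier (free_module R S)"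
    show "E f \<in> carrier P"
      unfolding E_def'
      by (rule P.M.finsum_closed) (use free_module_carrierD[OF f] assms(2) in \<open>auto simp: Pi_def image_subset_iff subset_iff\<close>)
  next
    fix f g assume f: "f \<in> carrier (free_module R S)" and g: "g \<in> carrier (free_module R S)"
    note fD = free_module_carrierD[OF f] and gD = free_module_carrierD[OF g]
    let ?T = "{s. f s \<noteq> \<zero>} \<union> {s. g s \<noteq> \<zero>}"
    have T: "finite ?T" "?T \<subseteq> S" using fD gD by auto
    have bc: "b s \<in> carrier P" if "s \<in> ?T" for s using that T assms(2) by auto
    have fg: "f \<oplus>\<^bsub>free_module R S\<^esub> g \<in> carrier (free_module R S)"
      using f g by (simp add: free_module_simps free_module_closed)
    have "E (f \<oplus>\<^bsub>free_module R S\<^esub> g) = (\<Oplus>\<^bsub>P\<^esub>s\<in>?T. (f \<oplus>\<^bsub>free_module R S\<^esub> g) s \<odot>\<^bsub>P\<^esub> b s)"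
      by (rule sup[OF fg T(1) _ T(2)]) (auto simp: free_module_simps)
    also have "\<dots> = (\<Oplus>\<^bsub>P\<^esub>s\<in>?T. f s \<odot>\<^bsub>P\<^esub> b s \<oplus>\<^bsub>P\<^esub> g s \<odot>\<^bsub>P\<^esub> b s)"
      by (rule P.M.add.finprod_cong')
        (use bc fD gD in \<open>auto simp: free_module_simps P.smult_l_distr Pi_def\<close>)
    also have "\<dots> = E f \<oplus>\<^bsub>P\<^esub> E g"
      using sup[OF f T(1) _ T(2)] sup[OF g T(1) _ T(2)] bc fD gD
      by (subst P.M.finsum_addf) (auto simp: Pi_def)
    finally show "E (f \<oplus>\<^bsub>free_module R S\<^esub> g) = E f \<oplus>\<^bsub>P\<^esub> E g" .
  next
    fix k f assume k: "k \<in> carrier R" and f: "f \<in> carrier (free_module R S)"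
    note fD = free_module_carrierD[OF f]
    let ?T = "{s. f s \<noteq> \<zero>}"
    have bc: "b s \<in> carrier P" if "s \<in> ?T" for s using that fD(3) assms(2) by auto
    have kf: "k \<odot>\<^bsub>free_module R S\<^esub> f \<in> carrier (free_module R S)"
      using k f by (simp add: free_module_simps free_module_closed)
    have "E (k \<odot>\<^bsub>free_module R S\<^esub> f) = (\<Oplus>\<^bsub>P\<^esub>s\<in>?T. (k \<odot>\<^bsub>free_module R S\<^esub> f) s \<odot>\<^bsub>P\<^esub> b s)"
      by (rule sup[OF kf fD(2) _ fD(3)]) (use k in \<open>auto simp: free_module_simps\<close>)
    also have "\<dots> = (\<Oplus>\<^bsub>P\<^esub>s\<in>?T. k \<odot>\<^bsub>P\<^esub> (f s \<odot>\<^bsub>P\<^esub> b s))"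
      by (rule P.M.add.finprod_cong')
        (use bc fD k in \<open>auto simp: free_module_simps P.smult_assoc1 Pi_def\<close>)
    also have "\<dots> = k \<odot>\<^bsub>P\<^esub> E f"
      unfolding E_def'
      by (rule P.finsum_smult_ldistr[symmetric]) (use bc fD k in \<open>auto simp: Pi_def\<close>)
    finally show "E (k \<odot>\<^bsub>free_module R S\<^esub> f) = k \<odot>\<^bsub>P\<^esub> E f" .
  qed
  show "free_lift R P b (free_gen R s) = b s" if s: "s \<in> S"
  proof -
    have "free_lift R P b (free_gen R s) = E (free_gen R s)" by (simp add: E_def)
    also have "\<dots> = (\<Oplus>\<^bsub>P\<^esub>t\<in>{s}. free_gen R s t \<odot>\<^bsub>P\<^esub> b t)"
      by (rule sup) (use s free_module_closed(4)[of s S] in \<open>auto simp: free_gen_def\<close>)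
    also have "\<dots> = b s" using s assms(2) by (auto simp: free_gen_def image_subset_iff)
    finally show ?thesis .
  qed
qed

end

lemma quotient_module_simps:
  assumes "module K M" "submodule U K M"
  shows "carrier (quotient_module M U) = (\<lambda>x. U +>\<^bsub>M\<^esub> x) ` carrier M"
    and "\<zero>\<^bsub>quotient_module M U\<^esub> = U +>\<^bsub>M\<^esub> \<zero>\<^bsub>M\<^esub>"
    and "x \<in> carrier M \<Longrightarrow> y \<in> carrier M \<Longrightarrow>
      (U +>\<^bsub>M\<^esub> x) \<oplus>\<^bsub>quotient_module M U\<^esub> (U +>\<^bsub>M\<^esub> y) = U +>\<^bsub>M\<^esub> (x \<oplus>\<^bsub>M\<^esub> y)"
    and "k \<in> carrier K \<Longrightarrow> x \<in> carrier M \<Longrightarrow>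
      k \<odot>\<^bsub>quotient_module M U\<^esub> (U +>\<^bsub>M\<^esub> x) = U +>\<^bsub>M\<^esub> (k \<odot>\<^bsub>M\<^esub> x)"
    and "x \<in> carrier M \<Longrightarrow> y \<in> carrier M \<Longrightarrow>
      U +>\<^bsub>M\<^esub> x = U +>\<^bsub>M\<^esub> y \<longleftrightarrow> x \<ominus>\<^bsub>M\<^esub> y \<in> U"
    and "x \<in> carrier M \<Longrightarrow> y \<in> U +>\<^bsub>M\<^esub> x \<Longrightarrow> y \<in> carrier M \<and> y \<ominus>\<^bsub>M\<^esub> x \<in> U"
    and "x \<in> carrier M \<Longrightarrow> x \<in> U +>\<^bsub>M\<^esub> x"
proof -
  interpret M: module K M by fact
  interpret U: submodule U K M by fact
  interpret U: abelian_subgroup U M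
    by (rule abelian_subgroupI3)
      (auto intro: additive_subgroup.intro U.subgroup_axioms M.abelian_group_axioms)
  show "carrier (quotient_module M U) = (\<lambda>x. U +>\<^bsub>M\<^esub> x) ` carrier M"
    by (auto simp: quotient_module_def A_RCOSETS_def')
  show "\<zero>\<^bsub>quotient_module M U\<^esub> = U +>\<^bsub>M\<^esub> \<zero>\<^bsub>M\<^esub>"
    using U.a_subset by (simp add: quotient_module_def)
  show "(U +>\<^bsub>M\<^esub> x) \<oplus>\<^bsub>quotient_module M U\<^esub> (U +>\<^bsub>M\<^esub> y) = U +>\<^bsub>M\<^esub> (x \<oplus>\<^bsub>M\<^esub> y)"
    if "x \<in> carrier M" "y \<in> carrier M"
    using that by (simp add: quotient_module_def U.a_rcos_sum)
  show self: "x \<in> U +>\<^bsub>M\<^esub> x" if "x \<in> carrier M" for x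
    using that U.a_rcos_self by blast
  show eq: "U +>\<^bsub>M\<^esub> x = U +>\<^bsub>M\<^esub> y \<longleftrightarrow> x \<ominus>\<^bsub>M\<^esub> y \<in> U" if "x \<in> carrier M" "y \<in> carrier M" for x y
  proof -
    have "x \<ominus>\<^bsub>M\<^esub> y \<in> U \<longleftrightarrow> x \<in> U +>\<^bsub>M\<^esub> y"
      using U.a_rcos_module[OF that(2,1)] by (simp add: a_minus_def)
    moreover have "U +>\<^bsub>M\<^esub> x = U +>\<^bsub>M\<^esub> y \<longleftrightarrow> x \<in> U +>\<^bsub>M\<^esub> y"
    proof
      assume eq: "U +>\<^bsub>M\<^esub> x = U +>\<^bsub>M\<^esub> y"
      show "x \<in> U +>\<^bsub>M\<^esub> y" unfolding eq[symmetric] by (rule self) fact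
    next
      assume "x \<in> U +>\<^bsub>M\<^esub> y"
      from M.a_repr_independence[OF this that(2) U.a_subgroup]
      show "U +>\<^bsub>M\<^esub> x = U +>\<^bsub>M\<^esub> y" by (rule sym)
    qed
    ultimately show ?thesis by simp
  qed
  show mem: "y \<in> carrier M \<and> y \<ominus>\<^bsub>M\<^esub> x \<in> U" if "x \<in> carrier M" "y \<in> U +>\<^bsub>M\<^esub> x" for x y
    using U.a_elemrcos_carrier[OF that] U.a_rcos_module_imp[OF that] by (simp add: a_minus_def)
  show "k \<odot>\<^bsub>quotient_module M U\<^esub> (U +>\<^bsub>M\<^esub> x) = U +>\<^bsub>M\<^esub> (k \<odot>\<^bsub>M\<^esub> x)"
    if k: "k \<in> carrier K" and x: "x \<in> carrier M"
  proof -
    have "U +>\<^bsub>M\<^esub> (k \<odot>\<^bsub>M\<^esub> y) = U +>\<^bsub>M\<^esub> (k \<odot>\<^bsub>M\<^esub> x)" if y: "y \<in> U +>\<^bsub>M\<^esub> x" for y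
    proof -
      have y': "y \<in> carrier M" "y \<ominus>\<^bsub>M\<^esub> x \<in> U" using mem[OF x y] by auto
      have "k \<odot>\<^bsub>M\<^esub> y \<ominus>\<^bsub>M\<^esub> k \<odot>\<^bsub>M\<^esub> x = k \<odot>\<^bsub>M\<^esub> (y \<ominus>\<^bsub>M\<^esub> x)"
        using k x y' by (simp add: a_minus_def M.smult_r_distr M.smult_r_minus)
      then show ?thesis using eq k x y' U.smult_closed by simp
    qed
    then have "(\<Union>y\<in>U +>\<^bsub>M\<^esub> x. U +>\<^bsub>M\<^esub> (k \<odot>\<^bsub>M\<^esub> y)) =
        (\<Union>y\<in>U +>\<^bsub>M\<^esub> x. U +>\<^bsub>M\<^esub> (k \<odot>\<^bsub>M\<^esub> x))"
      by (rule SUP_cong[OF refl])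
    also have "\<dots> = U +>\<^bsub>M\<^esub> (k \<odot>\<^bsub>M\<^esub> x)"
      by (rule UN_constant_eq) (use self[OF x] in auto)
    finally show ?thesis by (simp add: quotient_module_def)
  qed
qed

lemma quotient_module_module:
  assumes "module K M" "submodule U K M"
  shows "module K (quotient_module M U)"
proof -
  interpret M: module K M by fact
  note s = quotient_module_simps[OF assms]
  show ?thesis
  proof (rule moduleI)
    show "cring K" by unfold_locales
    show "abelian_group (quotient_module M U)"
    proof (rule abelian_groupI)
      fix X assume "X \<in> carrier (quotient_module M U)"
      then obtain x where x: "x \<in> carrier M" "X = U +>\<^bsub>M\<^esub> x" by (auto simp: s(1))
      show "\<exists>Y\<in>carrier (quotient_module M U).
        Y \<oplus>\<^bsub>quotient_module M U\<^esub> X = \<zero>\<^bsub>quotient_module M U\<^esub>"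
        by (rule bexI[where x = "U +>\<^bsub>M\<^esub> (\<ominus>\<^bsub>M\<^esub> x)"]) (use x in \<open>auto simp: s(1-4) M.M.l_neg\<close>)
    qed (auto simp: s(1-4) M.M.a_ac)
  qed (auto simp: s(1-4) M.smult_l_distr M.smult_r_distr M.smult_assoc1)
qed

lemma tensor_relatorsI:
  fixes K M N
  defines "F \<equiv> free_module K (carrier M \<times> carrier N)" and "d \<equiv> \<lambda>x y. free_gen K (x, y)"
  shows "x \<in> carrier M \<Longrightarrow> x' \<in> carrier M \<Longrightarrow> y \<in> carrier N \<Longrightarrow>
      d (x \<oplus>\<^bsub>M\<^esub> x') y \<ominus>\<^bsub>F\<^esub> (d x y \<oplus>\<^bsub>F\<^esub> d x' y) \<in> tensor_relators K M N"
    and "x \<in> carrier M \<Longrightarrow> y \<in> carrier N \<Longrightarrow> y' \<in> carrier N \<Longrightarrow>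
      d x (y \<oplus>\<^bsub>N\<^esub> y') \<ominus>\<^bsub>F\<^esub> (d x y \<oplus>\<^bsub>F\<^esub> d x y') \<in> tensor_relators K M N"
    and "k \<in> carrier K \<Longrightarrow> x \<in> carrier M \<Longrightarrow> y \<in> carrier N \<Longrightarrow>
      d (k \<odot>\<^bsub>M\<^esub> x) y \<ominus>\<^bsub>F\<^esub> (k \<odot>\<^bsub>F\<^esub> d x y) \<in> tensor_relators K M N"
    and "k \<in> carrier K \<Longrightarrow> x \<in> carrier M \<Longrightarrow> y \<in> carrier N \<Longrightarrow>
      d x (k \<odot>\<^bsub>N\<^esub> y) \<ominus>\<^bsub>F\<^esub> (k \<odot>\<^bsub>F\<^esub> d x y) \<in> tensor_relators K M N"
  unfolding tensor_relators_def Let_def F_def d_def by blast+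

lemma tensor_relators_carrier:
  assumes "module K M" "module K N"
  shows "tensor_relators K M N \<subseteq> carrier (free_module K (carrier M \<times> carrier N))"
proof -
  interpret M: module K M by fact
  interpret N: module K N by fact
  interpret F: module K "free_module K (carrier M \<times> carrier N)" by (rule M.R.free_module_module)
  show ?thesis
    by (auto simp: tensor_relators_def Let_def
        intro!: F.M.minus_closed F.M.add.m_closed F.smult_closed M.R.free_module_closed(4))
qed

lemma tensor_kernel_submodule:
  assumes "module K M" "module K N"
  shows "submodule (tensor_kernel K M N) K (free_module K (carrier M \<times> carrier N))"
    and "tensor_relators K M N \<subseteq> tensor_kernel K M N"
    and "submodule H K (free_module K (carrier M \<times> carrier N)) \<Longrightarrow> tensor_relators K M N \<subseteq> H
      \<Longrightarrow> tensor_kernel K M N \<subseteq> H"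
proof -
  interpret M: module K M by fact
  interpret N: module K N by fact
  interpret F: module K "free_module K (carrier M \<times> carrier N)" by (rule M.R.free_module_module)
  let ?\<H> = "{H. submodule H K (free_module K (carrier M \<times> carrier N)) \<and> tensor_relators K M N \<subseteq> H}"
  have ne: "carrier (free_module K (carrier M \<times> carrier N)) \<in> ?\<H>"
    using F.carrier_is_submodule tensor_relators_carrier[OF assms] by simp
  have sub: "H \<in> ?\<H> \<Longrightarrow> submodule H K (free_module K (carrier M \<times> carrier N))" for H by simp
  show "submodule (tensor_kernel K M N) K (free_module K (carrier M \<times> carrier N))"
  proof (rule F.submoduleI)
    show "tensor_kernel K M N \<subseteq> carrier (free_module K (carrier M \<times> carrier N))"
      using ne unfolding tensor_kernel_def by blast
    show "\<zero>\<^bsub>free_module K (carrier M \<times> carrier N)\<^esub> \<in> tensor_kernel K M N"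
      using subgroup.one_closed[OF submodule.axioms(1)] by (fastforce simp: tensor_kernel_def)
  qed (use F.submoduleE(3-5)[OF sub] in \<open>auto simp: tensor_kernel_def\<close>)
qed (auto simp: tensor_kernel_def)

lemma tensor_module:
  assumes "module K M" "module K N"
  shows "module K (tensor K M N)"
  unfolding tensor_def
  by (intro quotient_module_module tensor_kernel_submodule cring.free_module_module assms
      module.axioms(1)[OF assms(1)])

lemma pure_tensor_bilinear:
  assumes "module K M" "module K N"
  shows "pure_tensor K M N \<in> bilinear_maps K M N (tensor K M N)"
proof -
  interpret M: module K M by fact
  interpret N: module K N by fact
  let ?F = "free_module K (carrier M \<times> carrier N)"
  interpret F: module K ?F by (rule M.R.free_module_module)
  note U = tensor_kernel_submodule[OF assms]
  note s = quotient_module_simps[OF F.module_axioms U(1), folded tensor_def]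
  have d: "free_gen K (x, y) \<in> carrier ?F" if "x \<in> carrier M" "y \<in> carrier N" for x y
    using that by (simp add: M.R.free_module_closed)
  have eqI: "tensor_kernel K M N +>\<^bsub>?F\<^esub> f = tensor_kernel K M N +>\<^bsub>?F\<^esub> g"
    if "f \<ominus>\<^bsub>?F\<^esub> g \<in> tensor_relators K M N" "f \<in> carrier ?F" "g \<in> carrier ?F" for f g
    using that s(5) U(2) by blast
  have "(\<lambda>x. pure_tensor K M N x y) \<in> linear_maps K M (tensor K M N)" if y: "y \<in> carrier N" for y
  proof (rule linear_mapsI)
    fix x assume x: "x \<in> carrier M"
    show "pure_tensor K M N x y \<in> carrier (tensor K M N)"
      using d[OF x y] by (simp add: s(1) pure_tensor_def)
    fix x' assume x': "x' \<in> carrier M"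
    show "pure_tensor K M N (x \<oplus>\<^bsub>M\<^esub> x') y =
        pure_tensor K M N x y \<oplus>\<^bsub>tensor K M N\<^esub> pure_tensor K M N x' y"
      unfolding pure_tensor_def s(3)[OF d[OF x y] d[OF x' y]]
      by (rule eqI) (use x x' y in \<open>simp_all add: tensor_relatorsI d F.M.add.m_closed\<close>)
  next
    fix k x assume k: "k \<in> carrier K" and x: "x \<in> carrier M"
    show "pure_tensor K M N (k \<odot>\<^bsub>M\<^esub> x) y = k \<odot>\<^bsub>tensor K M N\<^esub> pure_tensor K M N x y"
      unfolding pure_tensor_def s(4)[OF k d[OF x y]]
      by (rule eqI) (use k x y in \<open>simp_all add: tensor_relatorsI d F.smult_closed\<close>)
  qed
  moreover have "pure_tensor K M N x \<in> linear_maps K N (tensor K M N)" if x: "x \<in> carrier M" for x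
  proof (rule linear_mapsI)
    fix y assume y: "y \<in> carrier N"
    show "pure_tensor K M N x y \<in> carrier (tensor K M N)"
      using d[OF x y] by (simp add: s(1) pure_tensor_def)
    fix y' assume y': "y' \<in> carrier N"
    show "pure_tensor K M N x (y \<oplus>\<^bsub>N\<^esub> y') =
        pure_tensor K M N x y \<oplus>\<^bsub>tensor K M N\<^esub> pure_tensor K M N x y'"
      unfolding pure_tensor_def s(3)[OF d[OF x y] d[OF x y']]
      by (rule eqI) (use x y y' in \<open>simp_all add: tensor_relatorsI d F.M.add.m_closed\<close>)
  next
    fix k y assume k: "k \<in> carrier K" and y: "y \<in> carrier N"
    show "pure_tensor K M N x (k \<odot>\<^bsub>N\<^esub> y) = k \<odot>\<^bsub>tensor K M N\<^esub> pure_tensor K M N x y"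
      unfolding pure_tensor_def s(4)[OF k d[OF x y]]
      by (rule eqI) (use k x y in \<open>simp_all add: tensor_relatorsI d F.smult_closed\<close>)
  qed
  ultimately show ?thesis by (auto simp: bilinear_maps_def)
qed

lemma tensor_lift_rep:
  assumes "module K M" "module K N" "module K P" "b \<in> bilinear_maps K M N P"
    and f: "f \<in> carrier (free_module K (carrier M \<times> carrier N))"
  shows "tensor_lift K P b (tensor_kernel K M N +>\<^bsub>free_module K (carrier M \<times> carrier N)\<^esub> f) =
    free_lift K P (\<lambda>(x, y). b x y) f"
proof -
  interpret M: module K M by fact
  interpret N: module K N by fact
  interpret P: module K P by fact
  let ?S = "carrier M \<times> carrier N"
  let ?F = "free_module K ?S"
  interpret F: module K ?F by (rule M.R.free_module_module)
  note U = tensor_kernel_submodule[OF assms(1,2)]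
  note s = quotient_module_simps[OF F.module_axioms U(1)]
  note bD = linear_mapsD[OF bilinear_mapsD(1)[OF assms(4)]]
    linear_mapsD[OF bilinear_mapsD(2)[OF assms(4)]]
  define E where "E = free_lift K P (\<lambda>(x, y). b x y)"
  note E = M.R.free_lift[OF assms(3) bilinear_mapsD(3)[OF assms(4)], folded E_def]
  note ED = linear_mapsD[OF E(1)]
  have d: "free_gen K (x, y) \<in> carrier ?F" if "x \<in> carrier M" "y \<in> carrier N" for x y
    using that by (simp add: M.R.free_module_closed)
  have Em: "E (g \<ominus>\<^bsub>?F\<^esub> h) = E g \<ominus>\<^bsub>P\<^esub> E h" if "g \<in> carrier ?F" "h \<in> carrier ?F" for g h
  proof -
    have "E g = E (g \<ominus>\<^bsub>?F\<^esub> h \<oplus>\<^bsub>?F\<^esub> h)"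
      using that by (simp add: a_minus_def F.M.a_assoc F.M.l_neg)
    also have "\<dots> = E (g \<ominus>\<^bsub>?F\<^esub> h) \<oplus>\<^bsub>P\<^esub> E h" using that by (simp add: ED)
    finally show ?thesis using that ED(1)
      by (simp add: a_minus_def P.M.a_assoc P.M.r_neg)
  qed
  have "tensor_relators K M N \<subseteq> {f \<in> carrier ?F. E f = \<zero>\<^bsub>P\<^esub>}"
    using tensor_relators_carrier[OF assms(1,2)]
    by (auto simp: tensor_relators_def Let_def Em d ED(2,3) E(2) bD P.M.r_neg a_minus_def[of P])
  then have ker: "tensor_kernel K M N \<subseteq> {f \<in> carrier ?F. E f = \<zero>\<^bsub>P\<^esub>}"
    by (intro U(3) linear_maps_kernel_submodule F.module_axioms assms(3) E(1))
  have "E g = E f" if "g \<in> tensor_kernel K M N +>\<^bsub>?F\<^esub> f" for g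
  proof -
    have "g \<in> carrier ?F" "g \<ominus>\<^bsub>?F\<^esub> f \<in> tensor_kernel K M N" using s(6)[OF f that] by auto
    moreover from this have "E g \<ominus>\<^bsub>P\<^esub> E f = \<zero>\<^bsub>P\<^esub>" using ker Em f by auto
    moreover have "E g = (E g \<ominus>\<^bsub>P\<^esub> E f) \<oplus>\<^bsub>P\<^esub> E f"
      using ED(1) f calculation(1) by (simp add: a_minus_def P.M.a_assoc P.M.l_neg)
    ultimately show ?thesis using ED(1)[OF f] by simp
  qed
  moreover have "(SOME g. g \<in> tensor_kernel K M N +>\<^bsub>?F\<^esub> f) \<in> tensor_kernel K M N +>\<^bsub>?F\<^esub> f"
    unfolding some_in_eq using s(7)[OF f] by blast
  ultimately show ?thesis
    by (simp add: tensor_lift_def E_def)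
qed

lemma tensor_lift_linear:
  assumes "module K M" "module K N" "module K P" "b \<in> bilinear_maps K M N P"
  shows "tensor_lift K P b \<in> linear_maps K (tensor K M N) P"
proof -
  interpret M: module K M by fact
  interpret N: module K N by fact
  interpret P: module K P by fact
  interpret F: module K "free_module K (carrier M \<times> carrier N)" by (rule M.R.free_module_module)
  note U = tensor_kernel_submodule[OF assms(1,2)]
  note s = quotient_module_simps[OF F.module_axioms U(1), folded tensor_def]
  note E = M.R.free_lift[OF assms(3) bilinear_mapsD(3)[OF assms(4)]]
  show ?thesis
    by (rule linear_mapsI)
      (auto simp: s(1,3,4) tensor_lift_rep[OF assms] linear_mapsD[OF E(1)])
qed

lemma tensor_lift_pure:
  assumes "module K M" "module K N" "module K P" "b \<in> bilinear_maps K M N P"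
    and "x \<in> carrier M" "y \<in> carrier N"
  shows "tensor_lift K P b (pure_tensor K M N x y) = b x y"
proof -
  interpret M: module K M by fact
  note E = M.R.free_lift[OF assms(3) bilinear_mapsD(3)[OF assms(4)]]
  have d: "free_gen K (x, y) \<in> carrier (free_module K (carrier M \<times> carrier N))"
    using assms(5,6) by (simp add: M.R.free_module_closed)
  show ?thesis
    using E(2)[of "(x, y)"] assms(5,6) tensor_lift_rep[OF assms(1-4) d] by (simp add: pure_tensor_def)
qed

lemma tensor_linear_unique:
  assumes "module K M" "module K N" "module K P"
    and g: "g \<in> linear_maps K (tensor K M N) P" and h: "h \<in> linear_maps K (tensor K M N) P"
    and eq: "\<And>x y. x \<in> carrier M \<Longrightarrow> y \<in> carrier N
      \<Longrightarrow> g (pure_tensor K M N x y) = h (pure_tensor K M N x y)"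
    and t: "t \<in> carrier (tensor K M N)"
  shows "g t = h t"
proof -
  interpret M: module K M by fact
  interpret N: module K N by fact
  interpret P: module K P by fact
  let ?S = "carrier M \<times> carrier N"
  let ?F = "free_module K ?S"
  interpret F: module K ?F by (rule M.R.free_module_module)
  note U = tensor_kernel_submodule[OF assms(1,2)]
  note s = quotient_module_simps[OF F.module_axioms U(1), folded tensor_def]
  note gD = linear_mapsD[OF g] and hD = linear_mapsD[OF h]
  interpret T: module K "tensor K M N" by (rule tensor_module) fact+
  have z: "g \<zero>\<^bsub>tensor K M N\<^esub> = \<zero>\<^bsub>P\<^esub>" "h \<zero>\<^bsub>tensor K M N\<^esub> = \<zero>\<^bsub>P\<^esub>"
    using gD(3)[of "\<zero>\<^bsub>K\<^esub>" "\<zero>\<^bsub>tensor K M N\<^esub>"] gD(1)[of "\<zero>\<^bsub>tensor K M N\<^esub>"]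
      hD(3)[of "\<zero>\<^bsub>K\<^esub>" "\<zero>\<^bsub>tensor K M N\<^esub>"] hD(1)[of "\<zero>\<^bsub>tensor K M N\<^esub>"] by simp_all
  obtain f where f: "f \<in> carrier ?F" "t = tensor_kernel K M N +>\<^bsub>?F\<^esub> f"
    using t by (auto simp: s(1))
  from f(1) have "g (tensor_kernel K M N +>\<^bsub>?F\<^esub> f) = h (tensor_kernel K M N +>\<^bsub>?F\<^esub> f)"
  proof (induction f rule: M.R.free_module_induct)
    case zero
    then show ?case using z s(2) by (simp add: M.R.free_module_simps)
  next
    case (step f k p)
    have d: "free_gen K p \<in> carrier ?F" using step by (simp add: M.R.free_module_closed)
    have c: "x \<in> carrier ?F \<Longrightarrow> tensor_kernel K M N +>\<^bsub>?F\<^esub> x \<in> carrier (tensor K M N)" for x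
      by (simp add: s(1))
    have "g (tensor_kernel K M N +>\<^bsub>?F\<^esub> free_gen K p) = h (tensor_kernel K M N +>\<^bsub>?F\<^esub> free_gen K p)"
      using eq[of "fst p" "snd p"] step by (auto simp: pure_tensor_def)
    then show ?case
      using step d c by (simp add: s(3,4)[symmetric] gD hD)
  qed
  then show ?thesis using f by simp
qed

lemma linear_maps_comp:
  "g \<in> linear_maps K N P \<Longrightarrow> f \<in> linear_maps K M N \<Longrightarrow> (\<lambda>x. g (f x)) \<in> linear_maps K M P"
  by (rule linear_mapsI) (simp_all add: linear_mapsD)

lemma linear_maps_add:
  assumes "module K P" "f \<in> linear_maps K M P" "g \<in> linear_maps K M P"
  shows "(\<lambda>x. f x \<oplus>\<^bsub>P\<^esub> g x) \<in> linear_maps K M P"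
proof -
  interpret P: module K P by fact
  show ?thesis
    by (rule linear_mapsI)
      (use assms(2,3) in \<open>simp_all add: linear_mapsD P.smult_r_distr P.M.add.m_ac\<close>)
qed

lemma linear_maps_smult:
  assumes "module K P" "f \<in> linear_maps K M P" "k \<in> carrier K"
  shows "(\<lambda>x. k \<odot>\<^bsub>P\<^esub> f x) \<in> linear_maps K M P"
proof -
  interpret P: module K P by fact
  show ?thesis
  proof (rule linear_mapsI)
    fix j x assume "j \<in> carrier K" "x \<in> carrier M"
    then show "k \<odot>\<^bsub>P\<^esub> f (j \<odot>\<^bsub>M\<^esub> x) = j \<odot>\<^bsub>P\<^esub> (k \<odot>\<^bsub>P\<^esub> f x)"
      using assms(2,3) by (simp add: linear_mapsD P.smult_assoc1[symmetric] P.R.m_comm)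
  qed (use assms(2,3) in \<open>simp_all add: linear_mapsD P.smult_r_distr\<close>)
qed

lemma tensor_assoc_pure:
  assumes M: "module K M" and N: "module K N" and P: "module K P"
    and "x \<in> carrier M" "y \<in> carrier N" "z \<in> carrier P"
  shows "tensor_assoc K M N P (pure_tensor K (tensor K M N) P (pure_tensor K M N x y) z) =
    pure_tensor K M (tensor K N P) x (pure_tensor K N P y z)"
proof -
  let ?T = "tensor K M (tensor K N P)"
  let ?q = "\<lambda>z x y. pure_tensor K M (tensor K N P) x (pure_tensor K N P y z)"
  note NP = tensor_module[OF N P] and MN = tensor_module[OF M N]
  note T = tensor_module[OF M NP]
  note p = bilinear_mapsD[OF pure_tensor_bilinear[OF M NP]]
  note p' = bilinear_mapsD[OF pure_tensor_bilinear[OF N P]]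
  note pc = linear_mapsD(1)[OF p'(2)] linear_mapsD(1)[OF bilinear_mapsD(2)[OF pure_tensor_bilinear[OF M N]]]
  have q: "?q z \<in> bilinear_maps K M N ?T" if "z \<in> carrier P" for z
    using linear_maps_comp[OF p(2) p'(1)[OF that]] p(1) pc(1) that by (auto simp: bilinear_maps_def)
  note l = tensor_lift_linear[OF M N T q] and lp = tensor_lift_pure[OF M N T q]
  note u = tensor_linear_unique[OF M N T l]
  interpret P: module K P by (rule P)
  have "tensor_lift K ?T (?q (z \<oplus>\<^bsub>P\<^esub> z')) t =
      tensor_lift K ?T (?q z) t \<oplus>\<^bsub>?T\<^esub> tensor_lift K ?T (?q z') t"
    if "z \<in> carrier P" "z' \<in> carrier P" "t \<in> carrier (tensor K M N)" for z z' t
    by (rule u[OF _ linear_maps_add[OF T l l]])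
      (use that in \<open>simp_all add: lp linear_mapsD[OF p'(2)] linear_mapsD[OF p(2)]\<close>)
  moreover have "tensor_lift K ?T (?q (k \<odot>\<^bsub>P\<^esub> z)) t = k \<odot>\<^bsub>?T\<^esub> tensor_lift K ?T (?q z) t"
    if "k \<in> carrier K" "z \<in> carrier P" "t \<in> carrier (tensor K M N)" for k z t
    by (rule u[OF _ linear_maps_smult[OF T l]])
      (use that in \<open>simp_all add: lp linear_mapsD[OF p'(2)] linear_mapsD[OF p(2)]\<close>)
  ultimately have "(\<lambda>z. tensor_lift K ?T (?q z) t) \<in> linear_maps K P ?T"
    if "t \<in> carrier (tensor K M N)" for t
    by (intro linear_mapsI) (use that in \<open>simp_all add: linear_mapsD[OF l]\<close>)
  then have "(\<lambda>t z. tensor_lift K ?T (?q z) t) \<in> bilinear_maps K (tensor K M N) P ?T"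
    using l by (simp add: bilinear_maps_def)
  from tensor_lift_pure[OF MN P T this] show ?thesis
    using assms(4-6) by (simp add: tensor_assoc_def Let_def lp pc)
qed

lemma tensor_map_linear:
  assumes "module K M" "module K N" "module K P" "module K Q"
    and "f \<in> linear_maps K M P" "g \<in> linear_maps K N Q"
  shows "tensor_map K P Q f g \<in> linear_maps K (tensor K M N) (tensor K P Q)"
    and "x \<in> carrier M \<Longrightarrow> y \<in> carrier N \<Longrightarrow>
      tensor_map K P Q f g (pure_tensor K M N x y) = pure_tensor K P Q (f x) (g y)"
proof -
  note p = bilinear_mapsD[OF pure_tensor_bilinear[OF assms(3,4)]]
  have b: "(\<lambda>x y. pure_tensor K P Q (f x) (g y)) \<in> bilinear_maps K M N (tensor K P Q)"
    unfolding bilinear_maps_def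
    using linear_maps_comp[OF p(1) assms(5)] linear_maps_comp[OF p(2) assms(6)]
      linear_mapsD(1)[OF assms(5)] linear_mapsD(1)[OF assms(6)] by auto
  note T = tensor_module[OF assms(3,4)]
  show "tensor_map K P Q f g \<in> linear_maps K (tensor K M N) (tensor K P Q)"
    unfolding tensor_map_def by (rule tensor_lift_linear[OF assms(1,2) T b])
  show "tensor_map K P Q f g (pure_tensor K M N x y) = pure_tensor K P Q (f x) (g y)"
    if "x \<in> carrier M" "y \<in> carrier N"
    unfolding tensor_map_def by (rule tensor_lift_pure[OF assms(1,2) T b that])
qed
subsection \<open>BiHom structures\<close>

text \<open>
  A multiplication on \<open>A\<close> is a linear map \<open>\<mu> : A \<otimes> A \<rightarrow> A\<close>, and the product of \<open>a\<close> and \<open>b\<close> is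
  \<open>\<mu> (a \<otimes> b)\<close>; no associativity or unit is assumed.
\<close>

abbreviation (input) prod_of ::
  "('k, 'r) ring_scheme \<Rightarrow> ('k, 'a, 'm) module_scheme \<Rightarrow> (('a \<times> 'a \<Rightarrow> 'k) set \<Rightarrow> 'a)
    \<Rightarrow> 'a \<Rightarrow> 'a \<Rightarrow> 'a"
  where "prod_of K A \<mu> a b \<equiv> \<mu> (pure_tensor K A A a b)"

definition algebra_map ::
  "('k, 'r) ring_scheme \<Rightarrow> ('k, 'a, 'm) module_scheme \<Rightarrow> (('a \<times> 'a \<Rightarrow> 'k) set \<Rightarrow> 'a)
    \<Rightarrow> ('a \<Rightarrow> 'a) \<Rightarrow> bool"
  where "algebra_map K A \<mu> f \<longleftrightarrow>
    f \<in> linear_maps K A A \<and>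
    (\<forall>a\<in>carrier A. \<forall>b\<in>carrier A. f (prod_of K A \<mu> a b) = prod_of K A \<mu> (f a) (f b))"

locale bihom_associative_algebra = K: field K + A: module K A
  for K :: "('k, 'r) ring_scheme" and A :: "('k, 'a, 'm) module_scheme"
  and \<mu> :: "('a \<times> 'a \<Rightarrow> 'k) set \<Rightarrow> 'a" and \<alpha> \<beta> :: "'a \<Rightarrow> 'a" +
  assumes mu_linear: "\<mu> \<in> linear_maps K (tensor K A A) A"
    and alpha_algebra_map: "algebra_map K A \<mu> \<alpha>"
    and beta_algebra_map: "algebra_map K A \<mu> \<beta>"
    and alpha_beta: "a \<in> carrier A \<Longrightarrow> \<alpha> (\<beta> a) = \<beta> (\<alpha> a)"
    and bihom_assoc: "\<lbrakk>a \<in> carrier A; b \<in> carrier A; c \<in> carrier A\<rbrakk> \<Longrightarrow>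
      prod_of K A \<mu> (\<alpha> a) (prod_of K A \<mu> b c) = prod_of K A \<mu> (prod_of K A \<mu> a b) (\<beta> c)"

locale bihom_coassociative_coalgebra = K: field K + A: module K A
  for K :: "('k, 'r) ring_scheme" and A :: "('k, 'a, 'm) module_scheme"
  and \<Delta> :: "'a \<Rightarrow> ('a \<times> 'a \<Rightarrow> 'k) set" and \<psi> \<omega> :: "'a \<Rightarrow> 'a" +
  assumes Delta_linear: "\<Delta> \<in> linear_maps K A (tensor K A A)"
    and psi_linear: "\<psi> \<in> linear_maps K A A"
    and omega_linear: "\<omega> \<in> linear_maps K A A"
    and psi_omega: "a \<in> carrier A \<Longrightarrow> \<psi> (\<omega> a) = \<omega> (\<psi> a)"
    and psi_Delta: "a \<in> carrier A \<Longrightarrow> tensor_map K A A \<psi> \<psi> (\<Delta> a) = \<Delta> (\<psi> a)"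
    and omega_Delta: "a \<in> carrier A \<Longrightarrow> tensor_map K A A \<omega> \<omega> (\<Delta> a) = \<Delta> (\<omega> a)"
    and bihom_coassoc: "a \<in> carrier A \<Longrightarrow>
      tensor_assoc K A A A (tensor_map K (tensor K A A) A \<Delta> \<psi> (\<Delta> a)) =
      tensor_map K A (tensor K A A) \<omega> \<Delta> (\<Delta> a)"

text \<open>
  In \<open>Delta_mult\<close> the term \<open>\<omega>(a)b\<^sub>1 \<otimes> \<beta>(b\<^sub>2)\<close> is \<open>(\<omega>(a)\<cdot>_ \<otimes> \<beta>)(\<Delta> b)\<close> and
  \<open>\<alpha>(a\<^sub>1) \<otimes> a\<^sub>2\<psi>(b)\<close> is \<open>(\<alpha> \<otimes> _\<cdot>\<psi>(b))(\<Delta> a)\<close>. The scalar \<open>\<lambda>\<close> is written \<open>l\<close>.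
\<close>

locale infBH_bialgebra =
  bihom_associative_algebra K A \<mu> \<alpha> \<beta> + bihom_coassociative_coalgebra K A \<Delta> \<psi> \<omega>
  for K :: "('k, 'r) ring_scheme" and l :: 'k and A :: "('k, 'a, 'm) module_scheme"
  and \<mu> :: "('a \<times> 'a \<Rightarrow> 'k) set \<Rightarrow> 'a" and \<Delta> :: "'a \<Rightarrow> ('a \<times> 'a \<Rightarrow> 'k) set"
  and \<alpha> \<beta> \<psi> \<omega> :: "'a \<Rightarrow> 'a" +
  assumes scalar_closed: "l \<in> carrier K"
    and alpha_psi: "a \<in> carrier A \<Longrightarrow> \<alpha> (\<psi> a) = \<psi> (\<alpha> a)"
    and alpha_omega: "a \<in> carrier A \<Longrightarrow> \<alpha> (\<omega> a) = \<omega> (\<alpha> a)"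
    and beta_psi: "a \<in> carrier A \<Longrightarrow> \<beta> (\<psi> a) = \<psi> (\<beta> a)"
    and beta_omega: "a \<in> carrier A \<Longrightarrow> \<beta> (\<omega> a) = \<omega> (\<beta> a)"
    and alpha_Delta: "a \<in> carrier A \<Longrightarrow> tensor_map K A A \<alpha> \<alpha> (\<Delta> a) = \<Delta> (\<alpha> a)"
    and beta_Delta: "a \<in> carrier A \<Longrightarrow> tensor_map K A A \<beta> \<beta> (\<Delta> a) = \<Delta> (\<beta> a)"
    and psi_algebra_map: "algebra_map K A \<mu> \<psi>"
    and omega_algebra_map: "algebra_map K A \<mu> \<omega>"
    and Delta_mult: "\<lbrakk>a \<in> carrier A; b \<in> carrier A\<rbrakk> \<Longrightarrow>
      \<Delta> (prod_of K A \<mu> a b) =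
        tensor_map K A A (\<lambda>x. prod_of K A \<mu> (\<omega> a) x) \<beta> (\<Delta> b)
        \<oplus>\<^bsub>tensor K A A\<^esub> tensor_map K A A \<alpha> (\<lambda>x. prod_of K A \<mu> x (\<psi> b)) (\<Delta> a)
        \<oplus>\<^bsub>tensor K A A\<^esub> l \<odot>\<^bsub>tensor K A A\<^esub> pure_tensor K A A (\<alpha> (\<omega> a)) (\<beta> (\<psi> b))"

definition weighted_derivation ::
  "('k, 'r) ring_scheme \<Rightarrow> 'k \<Rightarrow> ('k, 'a, 'm) module_scheme \<Rightarrow> (('a \<times> 'a \<Rightarrow> 'k) set \<Rightarrow> 'a)
    \<Rightarrow> ('a \<Rightarrow> 'a) \<Rightarrow> ('a \<Rightarrow> 'a) \<Rightarrow> ('a \<Rightarrow> 'a) \<Rightarrow> bool"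
  where "weighted_derivation K l A \<mu> \<xi> \<zeta> D \<longleftrightarrow>
    algebra_map K A \<mu> \<xi> \<and> algebra_map K A \<mu> \<zeta> \<and> D \<in> linear_maps K A A \<and>
    (\<forall>a\<in>carrier A. \<forall>b\<in>carrier A.
      D (prod_of K A \<mu> a b) =
        prod_of K A \<mu> (\<xi> a) (D b) \<oplus>\<^bsub>A\<^esub> prod_of K A \<mu> (D a) (\<zeta> b)
        \<oplus>\<^bsub>A\<^esub> l \<odot>\<^bsub>A\<^esub> prod_of K A \<mu> (\<xi> a) (\<zeta> b))"

end

theory Submission
  imports Defs
begin

text \<open>
  Apply \<open>\<mu>\<close> to the formula for \<open>\<Delta>(ab)\<close>. BiHom-associativity gives
  \<open>(\<omega>(a)x)\<beta>(y) = \<alpha>\<omega>(a)(xy)\<close> and \<open>\<alpha>(x)(y\<psi>(b)) = (xy)\<beta>\<psi>(b)\<close>, which turn its first two terms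
  into (with \<open>D = \<mu> \<circ> \<Delta>\<close>) \<open>\<alpha>\<omega>(a)D(b)\<close> and \<open>D(a)\<beta>\<psi>(b)\<close>.
\<close>

lemma algebra_map_comp:
  assumes "algebra_map K A \<mu> f" "algebra_map K A \<mu> g"
  shows "algebra_map K A \<mu> (f \<circ> g)"
  using assms linear_maps_comp[of f K A A g A] linear_mapsD(1)[of g K A A]
  by (auto simp: algebra_map_def comp_def)

context bihom_associative_algebra
begin

lemma prod_bilinear: "(\<lambda>x y. prod_of K A \<mu> x y) \<in> bilinear_maps K A A A"
  using bilinear_mapsD(1,2)[OF pure_tensor_bilinear[OF A.module_axioms A.module_axioms]]
    linear_maps_comp[OF mu_linear]
  by (auto simp: bilinear_maps_def)

lemmas prod_left_linear = bilinear_mapsD(1)[OF prod_bilinear]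
lemmas prod_right_linear = bilinear_mapsD(2)[OF prod_bilinear]

lemma mu_tensor_map_left_mult:
  assumes c: "c \<in> carrier A" and t: "t \<in> carrier (tensor K A A)"
  shows "\<mu> (tensor_map K A A (\<lambda>x. prod_of K A \<mu> c x) \<beta> t) = prod_of K A \<mu> (\<alpha> c) (\<mu> t)"
proof -
  note m = A.module_axioms
  have ac: "\<alpha> c \<in> carrier A" and b: "\<beta> \<in> linear_maps K A A"
    using alpha_algebra_map beta_algebra_map c by (auto simp: algebra_map_def linear_mapsD)
  note T = tensor_map_linear[OF m m m m prod_right_linear[OF c] b]
  show ?thesis
    by (rule tensor_linear_unique[OF m m m linear_maps_comp[OF mu_linear T(1)]
          linear_maps_comp[OF prod_right_linear[OF ac] mu_linear] _ t])
      (simp add: T(2) bihom_assoc c)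
qed

lemma mu_tensor_map_right_mult:
  assumes c: "c \<in> carrier A" and t: "t \<in> carrier (tensor K A A)"
  shows "\<mu> (tensor_map K A A \<alpha> (\<lambda>x. prod_of K A \<mu> x c) t) = prod_of K A \<mu> (\<mu> t) (\<beta> c)"
proof -
  note m = A.module_axioms
  have bc: "\<beta> c \<in> carrier A" and a: "\<alpha> \<in> linear_maps K A A"
    using alpha_algebra_map beta_algebra_map c by (auto simp: algebra_map_def linear_mapsD)
  note T = tensor_map_linear[OF m m m m a prod_left_linear[OF c]]
  show ?thesis
    by (rule tensor_linear_unique[OF m m m linear_maps_comp[OF mu_linear T(1)]
          linear_maps_comp[OF prod_left_linear[OF bc] mu_linear] _ t])
      (simp add: T(2) bihom_assoc c)
qed

end

theorem lemma3p4:
  fixes K :: "('k, 'r) ring_scheme" and l :: 'k and A :: "('k, 'a, 'm) module_scheme"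
    and \<mu> :: "('a \<times> 'a \<Rightarrow> 'k) set \<Rightarrow> 'a" and \<Delta> :: "'a \<Rightarrow> ('a \<times> 'a \<Rightarrow> 'k) set"
    and \<alpha> \<beta> \<psi> \<omega> :: "'a \<Rightarrow> 'a"
  assumes "infBH_bialgebra K l A \<mu> \<Delta> \<alpha> \<beta> \<psi> \<omega>"
  shows "weighted_derivation K l A \<mu> (\<alpha> \<circ> \<omega>) (\<beta> \<circ> \<psi>) (\<mu> \<circ> \<Delta>)"
proof -
  interpret infBH_bialgebra K l A \<mu> \<Delta> \<alpha> \<beta> \<psi> \<omega> by fact
  note m = A.module_axioms
  interpret T: module K "tensor K A A" by (rule tensor_module[OF m m])
  have lin: "\<alpha> \<in> linear_maps K A A" "\<beta> \<in> linear_maps K A A"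
    using alpha_algebra_map beta_algebra_map by (simp_all add: algebra_map_def)
  note p = linear_mapsD(1)[OF bilinear_mapsD(2)[OF pure_tensor_bilinear[OF m m]]]
  note cl = lin[THEN linear_mapsD(1)] psi_linear[THEN linear_mapsD(1)]
    omega_linear[THEN linear_mapsD(1)] Delta_linear[THEN linear_mapsD(1)]
  have "\<mu> (\<Delta> (prod_of K A \<mu> a b)) =
      prod_of K A \<mu> (\<alpha> (\<omega> a)) (\<mu> (\<Delta> b)) \<oplus>\<^bsub>A\<^esub> prod_of K A \<mu> (\<mu> (\<Delta> a)) (\<beta> (\<psi> b))
      \<oplus>\<^bsub>A\<^esub> l \<odot>\<^bsub>A\<^esub> prod_of K A \<mu> (\<alpha> (\<omega> a)) (\<beta> (\<psi> b))"
    if a: "a \<in> carrier A" and b: "b \<in> carrier A" for a b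
  proof -
    have "tensor_map K A A (\<lambda>x. prod_of K A \<mu> (\<omega> a) x) \<beta> (\<Delta> b) \<in> carrier (tensor K A A)"
      "tensor_map K A A \<alpha> (\<lambda>x. prod_of K A \<mu> x (\<psi> b)) (\<Delta> a) \<in> carrier (tensor K A A)"
      using linear_mapsD(1)[OF tensor_map_linear(1)[OF m m m m prod_right_linear lin(2)]]
        linear_mapsD(1)[OF tensor_map_linear(1)[OF m m m m lin(1) prod_left_linear]] a b
      by (simp_all add: cl)
    then show ?thesis
      using a b scalar_closed
      by (simp add: Delta_mult linear_mapsD[OF mu_linear] cl p
          mu_tensor_map_left_mult mu_tensor_map_right_mult)
  qed
  then show ?thesis
    using algebra_map_comp[OF alpha_algebra_map omega_algebra_map]
      algebra_map_comp[OF beta_algebra_map psi_algebra_map]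
      linear_maps_comp[OF mu_linear Delta_linear]
    by (simp add: weighted_derivation_def comp_def)
qed

end
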